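(* Let $p\ge1$, $n\ge2$, and consider $(p+1)$-variate data with univariate nonresponse, given by rows $(X_i^{(1)},\dots,X_i^{(p)},Y_i,R_i)$, $i=1,\dots,n$, where $X_i^{(u)}$ are real and completely observed and $R_i\in\{0,1\}$ is the response indicator of $Y_i$. Let $\bar R_n=\frac1n\sum_{i=1}^n R_i$, $\bar X_n^{(u)}=\frac1n\sum_{i=1}^nX_i^{(u)}$, and let $\boldsymbol{\tilde\Sigma}$ be the $p\times p$ matrix with entries $$\boldsymbol{\tilde\Sigma}_{u,u'}=\left(\frac1n\sum_{i=1}^n\big(X_i^{(u)}-\bar X_n^{(u)}\big)\big(X_i^{(u')}-\bar X_n^{(u')}\big)\right)\bar R_n(1-\bar R_n).$$ Assume $0<\bar R_n<1$ and that $\boldsymbol{\tilde\Sigma}$ is invertible. Then $$A_n=d^2,$$ where $$A_n=n\left(\tilde T_n^{(1)},\dots,\tilde T_n^{(p)}\right)\boldsymbol{\tilde\Sigma}^{-1}\left(\tilde T_n^{(1)},\dots,\tilde T_n^{(p)}\right)^T,\qquad \tilde T_n^{(u)}=\bar X_n^{(u)}\bar R_n-\frac1n\sum_{i=1}^nX_i^{(u)}R_i,$$ and $$d^2=n\bar R_n^2(1-\bar R_n)\,L\,\boldsymbol{\tilde\Sigma}^{-1}L^T+n\bar R_n(1-\bar R_n)^2\,L_1'\,\boldsymbol{\tilde\Sigma}^{-1}L_1'^T,$$ with row vectors $L,L_1'\in\mathbb R^p$ having components, for $u=1,\dots,p$, $$L^{(u)}=\frac{1}{\sum_{i=1}^nR_i}\sum_{i=1}^nX_i^{(u)}R_i-\bar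 X_n^{(u)},\qquad (L_1')^{(u)}=\frac{1}{\sum_{i=1}^n(1-R_i)}\sum_{i=1}^nX_i^{(u)}(1-R_i)-\bar X_n^{(u)}.$$
   Context: $R_i=1$ if $Y_i$ is observed and $R_i=0$ otherwise. The matrix $\boldsymbol{\tilde\Sigma}$ is the maximum likelihood (not bias-adjusted) estimate of the covariance matrix of $(X^{(1)},\dots,X^{(p)})$ multiplied by the maximum likelihood estimate $\bar R_n(1-\bar R_n)$ of the variance of $R$. $A_n$ is the test statistic for the hypothesis of data missing completely at random in the univariate nonresponse case, and $d^2$ is the form taken in this case by Little's MCAR test statistic. *)

theory Defs
  imports "HOL-Analysis.Analysis"
begin

(* Samples are indexed by i = 1, ..., n and the p fully observed variables by the
   finite type 'p, so that X i $ u stands for X_i^(u).  The response indicator R is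
   real-valued so that it can be averaged directly. *)

definition sample_mean :: "nat \<Rightarrow> (nat \<Rightarrow> real) \<Rightarrow> real" where
  "sample_mean n Z = (1 / real n) * (\<Sum>i=1..n. Z i)"

definition response_indicator :: "nat \<Rightarrow> (nat \<Rightarrow> real option) \<Rightarrow> (nat \<Rightarrow> real) \<Rightarrow> bool" where
  "response_indicator n Y R \<longleftrightarrow>
     (\<forall>i\<in>{1..n}. R i = (case Y i of None \<Rightarrow> 0 | Some _ \<Rightarrow> 1))"

(* Both factors are maximum likelihood estimates, with divisor n rather than n - 1. *)
definition Sigma_tilde :: "nat \<Rightarrow> (nat \<Rightarrow> real ^ 'p) \<Rightarrow> (nat \<Rightarrow> real) \<Rightarrow> real ^ 'p ^ 'p" where
  "Sigma_tilde n X R = (\<chi> u u'.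
     (1 / real n) *
     (\<Sum>i=1..n. (X i $ u - sample_mean n (\<lambda>j. X j $ u)) *
                (X i $ u' - sample_mean n (\<lambda>j. X j $ u'))) *
     (sample_mean n R * (1 - sample_mean n R)))"

definition T_tilde :: "nat \<Rightarrow> (nat \<Rightarrow> real ^ 'p) \<Rightarrow> (nat \<Rightarrow> real) \<Rightarrow> real ^ 'p" where
  "T_tilde n X R = (\<chi> u.
     sample_mean n (\<lambda>i. X i $ u) * sample_mean n R - (1 / real n) * (\<Sum>i=1..n. X i $ u * R i))"

(* The quadratic form v M v^T of a row vector v. *)
definition quad_form :: "real ^ 'p \<Rightarrow> real ^ 'p ^ 'p \<Rightarrow> real" where
  "quad_form v M = (v v* M) \<bullet> v"

definition A_stat :: "nat \<Rightarrow> (nat \<Rightarrow> real ^ 'p) \<Rightarrow> (nat \<Rightarrow> real) \<Rightarrow> real" where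
  "A_stat n X R = real n * quad_form (T_tilde n X R) (matrix_inv (Sigma_tilde n X R))"

definition L_observed :: "nat \<Rightarrow> (nat \<Rightarrow> real ^ 'p) \<Rightarrow> (nat \<Rightarrow> real) \<Rightarrow> real ^ 'p" where
  "L_observed n X R = (\<chi> u.
     (1 / (\<Sum>i=1..n. R i)) * (\<Sum>i=1..n. X i $ u * R i) - sample_mean n (\<lambda>i. X i $ u))"

definition L_missing :: "nat \<Rightarrow> (nat \<Rightarrow> real ^ 'p) \<Rightarrow> (nat \<Rightarrow> real) \<Rightarrow> real ^ 'p" where
  "L_missing n X R = (\<chi> u.
     (1 / (\<Sum>i=1..n. 1 - R i)) * (\<Sum>i=1..n. X i $ u * (1 - R i)) - sample_mean n (\<lambda>i. X i $ u))"

(* Little's MCAR statistic d^2 with two missingness patterns (Y observed, Y missing).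
   The scalar weights carry one extra factor Rbar (1 - Rbar) each because Sigma_tilde is
   the covariance estimate of X multiplied by that number. *)
definition little_d2 :: "nat \<Rightarrow> (nat \<Rightarrow> real ^ 'p) \<Rightarrow> (nat \<Rightarrow> real) \<Rightarrow> real" where
  "little_d2 n X R =
     real n * (sample_mean n R)\<^sup>2 * (1 - sample_mean n R) *
       quad_form (L_observed n X R) (matrix_inv (Sigma_tilde n X R)) +
     real n * sample_mean n R * (1 - sample_mean n R)\<^sup>2 *
       quad_form (L_missing n X R) (matrix_inv (Sigma_tilde n X R))"

end

theory Submission
  imports Defs
begin

text \<open>Both pattern means deviate from the overall mean along the same direction: with
  \<open>r\<close> the response rate, \<open>T = - r L = (1 - r) L\<^sub>1'\<close>. Substituting, the two summands of
  \<open>d\<^sup>2\<close> become \<open>n (1 - r)\<close> and \<open>n r\<close> times the quadratic form at \<open>T\<close>, which add up to \<open>A\<^sub>n\<close>.\<close>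

lemma quad_form_scaleR: "quad_form (c *\<^sub>R v) M = c\<^sup>2 * quad_form v M"
  by (simp add: quad_form_def vector_matrix_mult_def inner_vec_def power2_eq_square
      sum_distrib_left sum_distrib_right algebra_simps)

lemma sum_eq_sample_mean:
  assumes "n \<noteq> 0"
  shows "(\<Sum>i=1..n. Z i) = real n * sample_mean n Z"
  using assms by (simp add: sample_mean_def)

text \<open>The number of responses is \<open>n\<close> times the response rate, so the factor
  \<open>n\<close> cancels in the mean over the observed rows.\<close>

lemma T_tilde_eq_L_observed:
  assumes "sample_mean n R \<noteq> 0"
  shows "T_tilde n X R = (- sample_mean n R) *\<^sub>R L_observed n X R"
proof -
  \<comment> \<open>Division by zero gives 0, so an empty sample would have mean 0.\<close>
  have "n \<noteq> 0"
    using assms by (auto simp: sample_mean_def)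
  with assms show ?thesis
    \<comment> \<open>\<open>One_nat_def\<close> would turn the bound \<open>1\<close> into
      \<open>Suc 0\<close> and block \<open>sum_eq_sample_mean\<close>.\<close>
    by (simp add: vec_eq_iff T_tilde_def L_observed_def sum_eq_sample_mean field_simps
        del: One_nat_def)
qed

lemma T_tilde_eq_L_missing:
  assumes "n \<noteq> 0" and "sample_mean n R \<noteq> 1"
  shows "T_tilde n X R = (1 - sample_mean n R) *\<^sub>R L_missing n X R"
proof -
  have "(\<Sum>i=1..n. 1 - R i) = real n * (1 - sample_mean n R)"
    using assms(1) by (simp add: sum_subtractf sum_eq_sample_mean algebra_simps
        del: One_nat_def)
  moreover have "(\<Sum>i=1..n. X i $ u * (1 - R i))
      = real n * (sample_mean n (\<lambda>i. X i $ u) - sample_mean n (\<lambda>i. X i $ u * R i))" for u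
    using assms(1) by (simp add: right_diff_distrib sum_subtractf sum_eq_sample_mean
        del: One_nat_def)
  \<comment> \<open>Here \<open>a\<close> is the mean of a variable, \<open>b\<close> that of its
    product with \<open>R\<close>, and \<open>r\<close> the response rate;
    \<open>(a - b) / (1 - r)\<close> is then the mean over the missing rows.\<close>
  moreover have "a * r - b = (1 - r) * ((a - b) / (1 - r) - a)" if "r \<noteq> 1" for a b r :: real
  proof -
    have "(1 - r) * ((a - b) / (1 - r)) = a - b"
      using that by simp
    then show ?thesis
      by algebra
  qed
  ultimately show ?thesis
    unfolding T_tilde_def L_missing_def
    using assms by (simp add: vec_eq_iff sum_eq_sample_mean del: One_nat_def)
qed

theorem theorem5:
  fixes n :: nat
    and X :: "nat \<Rightarrow> real ^ 'p"
    and Y :: "nat \<Rightarrow> real option"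
    and R :: "nat \<Rightarrow> real"
  assumes "n \<ge> 2"
    and "response_indicator n Y R"
    and "0 < sample_mean n R" and "sample_mean n R < 1"
    and "invertible (Sigma_tilde n X R)"
  shows "A_stat n X R = little_d2 n X R"
proof -
  define q where "q v = quad_form v (matrix_inv (Sigma_tilde n X R))" for v
  define r where "r = sample_mean n R"
  have "q (T_tilde n X R) = r\<^sup>2 * q (L_observed n X R)"
    \<comment> \<open>The minus sign has to stay inside the scalar, where
      \<open>quad_form_scaleR\<close> squares it away.\<close>
    using assms by (simp add: T_tilde_eq_L_observed quad_form_scaleR q_def r_def
        del: scaleR_minus_left)
  moreover have "q (T_tilde n X R) = (1 - r)\<^sup>2 * q (L_missing n X R)"
    using assms by (simp add: T_tilde_eq_L_missing quad_form_scaleR q_def r_def)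
  moreover have "little_d2 n X R = real n * ((1 - r) * (r\<^sup>2 * q (L_observed n X R))
      + r * ((1 - r)\<^sup>2 * q (L_missing n X R)))"
    by (simp add: little_d2_def q_def r_def algebra_simps)
  ultimately have "little_d2 n X R
      = real n * ((1 - r) * q (T_tilde n X R) + r * q (T_tilde n X R))"
    by simp
  then show ?thesis
    by (simp add: A_stat_def q_def algebra_simps)
qed

end
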